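(* For every $d\in\mathbb N$ and $0<\delta<1$, the logarithmic-shell family $\mathcal B_{d,\delta}^{\rm sh}$ is a $\delta$-bracketing cover and its endpoint set $\Gamma_{d,\delta}^{\rm sh}$ is a $\delta$-cover.
   Context: For $\boldsymbol x\in[0,1]^d$ put $V(\boldsymbol x)=\prod_{j=1}^d x_j$; $\boldsymbol x\le\boldsymbol y$ is coordinatewise. If $\boldsymbol x\le\boldsymbol y$ in $[0,1]^d$, the box $[\boldsymbol x,\boldsymbol y]$ is a $\delta$-bracket when $V(\boldsymbol y)-V(\boldsymbol x)\le\delta$. A $\delta$-bracketing cover is a finite family of $\delta$-brackets whose union is $[0,1]^d$. A finite set $\Gamma\subset[0,1]^d$ is a $\delta$-cover if for every $\boldsymbol z\in[0,1]^d$ there are $\boldsymbol x,\boldsymbol y\in\Gamma\cup\{\boldsymbol 0\}$ with $\boldsymbol x\le\boldsymbol z\le\boldsymbol y$ and $V(\boldsymbol y)-V(\boldsymbol x)\le\delta$. Shell construction for given $d,\delta$: define recursively $L_0=0$, $c_i:=\log(1+\delta e^{L_i})$, $L_{i+1}:=\min\{L_i+c_i/\sqrt{d\delta},\ d\log(\delta^{-1})\}$, and let $J$ be the first index with $L_J=d\log(\delta^{-1})$ (it exists). For $0\le i<J$ put \[ r_i^-:=\max\Bigl\{0,\Bigl\lceil d\Bigl(\frac{L_i}{c_i}-1\Bigr)\Bigr\rceil\Bigr\},\qquad r_i^+:=\Bigl\lceil\frac{dL_{i+1}}{c_i}\Bigr\rceil-1, \] $\mathcal A_i:=\{\boldsymbol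 n\in\mathbb N_0^d: r_i^-\le|\boldsymbol n|\le r_i^+\}$ with $|\boldsymbol n|=\sum_j n_j$. For $\boldsymbol n\in\mathcal A_i$ let $\boldsymbol x_{i,\boldsymbol n},\boldsymbol y_{i,\boldsymbol n}$ have coordinates $x_{i,\boldsymbol n,j}=\exp(-c_i(n_j+1)/d)$, $y_{i,\boldsymbol n,j}=\exp(-c_in_j/d)$. For $1\le j\le d$ let $\boldsymbol b^{(j)}$ have $j$th coordinate $\delta$ and all other coordinates $1$. Then \[ \mathcal B_{d,\delta}^{\rm sh}:=\{[\boldsymbol0,\boldsymbol b^{(j)}]:1\le j\le d\}\cup\{[\boldsymbol x_{i,\boldsymbol n},\boldsymbol y_{i,\boldsymbol n}]:0\le i<J,\ \boldsymbol n\in\mathcal A_i\}, \] \[ \Gamma_{d,\delta}^{\rm sh}:=\{\boldsymbol b^{(j)}:1\le j\le d\}\cup\{\boldsymbol x_{i,\boldsymbol n},\boldsymbol y_{i,\boldsymbol n}:0\le i<J,\ \boldsymbol n\in\mathcal A_i\}. \] *)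

theory Defs
  imports "HOL-Analysis.Analysis"
begin

text \<open>
  Points of \<open>[0,1]\<^sup>d\<close> are vectors of type \<^typ>\<open>real ^ 'n\<close> with \<open>d = CARD('n) \<ge> 1\<close>. The library
  order on this type is the coordinatewise one, so \<open>{x..y}\<close> is the box with corners \<open>x\<close> and \<open>y\<close>,
  and \<open>{0..1}\<close> is the unit cube.
\<close>

definition anchored_vol :: "real ^ 'n \<Rightarrow> real" where
  "anchored_vol x = (\<Prod>j\<in>UNIV. x $ j)"

definition delta_bracket :: "real \<Rightarrow> (real ^ 'n) set \<Rightarrow> bool" where
  "delta_bracket \<delta> B \<longleftrightarrow>
     (\<exists>x\<in>{0..1}. \<exists>y\<in>{0..1}. x \<le> y \<and> B = {x..y} \<and> anchored_vol y - anchored_vol x \<le> \<delta>)"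

definition delta_bracketing_cover :: "real \<Rightarrow> (real ^ 'n) set set \<Rightarrow> bool" where
  "delta_bracketing_cover \<delta> \<B> \<longleftrightarrow>
     finite \<B> \<and> (\<forall>B\<in>\<B>. delta_bracket \<delta> B) \<and> \<Union>\<B> = {0..1}"

definition delta_cover :: "real \<Rightarrow> (real ^ 'n) set \<Rightarrow> bool" where
  "delta_cover \<delta> \<Gamma> \<longleftrightarrow>
     finite \<Gamma> \<and> \<Gamma> \<subseteq> {0..1} \<and>
     (\<forall>z\<in>{0..1}. \<exists>x\<in>\<Gamma> \<union> {0}. \<exists>y\<in>\<Gamma> \<union> {0}.
        x \<le> z \<and> z \<le> y \<and> anchored_vol y - anchored_vol x \<le> \<delta>)"

definition shell_width :: "real \<Rightarrow> real \<Rightarrow> real" where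
  "shell_width \<delta> L = ln (1 + \<delta> * exp L)"

primrec shell_L :: "nat \<Rightarrow> real \<Rightarrow> nat \<Rightarrow> real" where
  "shell_L d \<delta> 0 = 0"
| "shell_L d \<delta> (Suc i) =
     min (shell_L d \<delta> i + shell_width \<delta> (shell_L d \<delta> i) / sqrt (real d * \<delta>))
         (real d * ln (inverse \<delta>))"

definition shell_c :: "nat \<Rightarrow> real \<Rightarrow> nat \<Rightarrow> real" where
  "shell_c d \<delta> i = shell_width \<delta> (shell_L d \<delta> i)"

text \<open>The index below is attained for \<open>d \<ge> 1\<close> and \<open>0 < \<delta> < 1\<close>; see \<open>shell_J_attained\<close>.\<close>

definition shell_J :: "nat \<Rightarrow> real \<Rightarrow> nat" where
  "shell_J d \<delta> = (LEAST i. shell_L d \<delta> i = real d * ln (inverse \<delta>))"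

definition shell_rminus :: "nat \<Rightarrow> real \<Rightarrow> nat \<Rightarrow> int" where
  "shell_rminus d \<delta> i = max 0 \<lceil>real d * (shell_L d \<delta> i / shell_c d \<delta> i - 1)\<rceil>"

definition shell_rplus :: "nat \<Rightarrow> real \<Rightarrow> nat \<Rightarrow> int" where
  "shell_rplus d \<delta> i = \<lceil>real d * shell_L d \<delta> (Suc i) / shell_c d \<delta> i\<rceil> - 1"

definition shell_A :: "real \<Rightarrow> nat \<Rightarrow> (nat ^ 'n) set" where
  "shell_A \<delta> i =
     {n. shell_rminus CARD('n) \<delta> i \<le> int (\<Sum>j\<in>UNIV. n $ j) \<and>
         int (\<Sum>j\<in>UNIV. n $ j) \<le> shell_rplus CARD('n) \<delta> i}"

definition shell_x :: "real \<Rightarrow> nat \<Rightarrow> nat ^ 'n \<Rightarrow> real ^ 'n" where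
  "shell_x \<delta> i n =
     (\<chi> j. exp (- shell_c CARD('n) \<delta> i * (real (n $ j) + 1) / real CARD('n)))"

definition shell_y :: "real \<Rightarrow> nat \<Rightarrow> nat ^ 'n \<Rightarrow> real ^ 'n" where
  "shell_y \<delta> i n =
     (\<chi> j. exp (- shell_c CARD('n) \<delta> i * real (n $ j) / real CARD('n)))"

definition shell_b :: "real \<Rightarrow> 'n \<Rightarrow> real ^ 'n" where
  "shell_b \<delta> j = (\<chi> k. if k = j then \<delta> else 1)"

definition shell_family :: "real \<Rightarrow> (real ^ 'n) set set" where
  "shell_family \<delta> =
     {{0..shell_b \<delta> j} | j. True} \<union>
     {{shell_x \<delta> i n..shell_y \<delta> i n} | i n. i < shell_J CARD('n) \<delta> \<and> n \<in> shell_A \<delta> i}"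

definition shell_points :: "real \<Rightarrow> (real ^ 'n) set" where
  "shell_points \<delta> =
     {shell_b \<delta> j | j. True} \<union>
     {shell_x \<delta> i n | i n. i < shell_J CARD('n) \<delta> \<and> n \<in> shell_A \<delta> i} \<union>
     {shell_y \<delta> i n | i n. i < shell_J CARD('n) \<delta> \<and> n \<in> shell_A \<delta> i}"

lemma shell_J_attained:
  assumes "d \<ge> 1" "0 < \<delta>" "\<delta> < 1"
  shows "shell_L d \<delta> (shell_J d \<delta>) = real d * ln (inverse \<delta>)"
proof -
  define M where "M = real d * ln (inverse \<delta>)"
  define s where "s = ln (1 + \<delta>) / sqrt (real d * \<delta>)"
  have M: "M \<ge> 0"
    unfolding M_def using assms by (intro mult_nonneg_nonneg ln_ge_zero) (auto simp: one_le_inverse_iff)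
  have s: "s > 0" using assms by (auto simp: s_def intro!: divide_pos_pos ln_gt_zero)
  have nonneg: "shell_L d \<delta> i \<ge> 0" for i
  proof (induction i)
    case (Suc i)
    have "shell_width \<delta> (shell_L d \<delta> i) \<ge> 0"
      using assms by (simp add: shell_width_def)
    then show ?case
      using Suc M assms by (simp add: M_def)
  qed simp
  have low: "shell_L d \<delta> i \<ge> min (real i * s) M" for i
  proof (induction i)
    case 0
    then show ?case using M by simp
  next
    case (Suc i)
    have "exp (shell_L d \<delta> i) \<ge> 1" using nonneg by simp
    then have "shell_width \<delta> (shell_L d \<delta> i) \<ge> ln (1 + \<delta>)"
      unfolding shell_width_def using assms by (intro ln_mono) auto
    then have "shell_width \<delta> (shell_L d \<delta> i) / sqrt (real d * \<delta>) \<ge> s"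
      unfolding s_def using assms by (intro divide_right_mono) auto
    then show ?case
      using Suc s by (auto simp: M_def[symmetric] algebra_simps min_def split: if_splits)
  qed
  have up: "shell_L d \<delta> i \<le> M" for i
    by (cases i) (use M in \<open>auto simp: M_def\<close>)
  obtain i :: nat where "M < real i * s"
    using s reals_Archimedean3 by blast
  then have "shell_L d \<delta> i = M"
    using low[of i] up[of i] by simp
  then show ?thesis
    unfolding shell_J_def M_def by (rule LeastI)
qed

end

theory Submission
  imports Defs
begin

text \<open>
  Put \<open>t\<^sub>j = - ln z\<^sub>j\<close>, so that the cube becomes the positive orthant and \<open>V z\<close> becomes
  \<open>exp (- (\<Sum>j. t\<^sub>j))\<close>. In these coordinates the \<open>i\<close>-th shell boxes are cells of a cubic grid of mesh
  \<open>c / d\<close>, where \<open>c = c\<^sub>i\<close> and \<open>L = L\<^sub>i\<close>.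

  Each cell is a bracket because the volume at its lower corner is the volume at its upper corner
  times \<open>exp (-c)\<close>. The volume gap of cell \<open>n\<close> is therefore \<open>exp (- c |n| / d) (1 - exp (-c))\<close>. The
  lower bound on \<open>|n|\<close> makes the first factor at most \<open>exp (c - L)\<close>, so the gap is at most
  \<open>exp (-L) (exp c - 1)\<close>, and the choice \<open>c = ln (1 + \<delta> exp L)\<close> is exactly what turns this into
  \<open>\<delta>\<close> (\<open>shell_cell_gap_le\<close>).

  The boxes cover because a point outside all the boxes \<open>[0, b\<^sup>(\<^sup>j\<^sup>)]\<close> has every \<open>t\<^sub>j < ln (1/\<delta>)\<close>,
  so \<open>T = (\<Sum>j. t\<^sub>j)\<close> lies below the last level \<open>d ln (1/\<delta>)\<close> and hence in some \<open>[L\<^sub>i, L\<^sub>i\<^sub>+\<^sub>1)\<close>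
  (\<open>shell_level_exists\<close>). Rounding each \<open>t\<^sub>j\<close> down to the grid moves the coordinate sum by less than
  \<open>d\<close> mesh widths, and \<open>r\<^sup>-\<close>, \<open>r\<^sup>+\<close> are the bounds on \<open>|n|\<close> that result (\<open>shell_cells_cover\<close>).

  Both conclusions then follow from a single pointwise fact (\<open>slab_or_shell_cell\<close>): every point of
  the cube lies in a bracket whose corners belong to \<open>\<Gamma> \<union> {0}\<close>.
\<close>

section \<open>Volume gap of a shell cell\<close>

lemma shell_c_pos:
  assumes "0 < \<delta>"
  shows "0 < shell_c d \<delta> i"
  using assms by (simp add: shell_c_def shell_width_def add_pos_pos)

lemma exp_shell_c:
  assumes "0 < \<delta>"
  shows "exp (shell_c d \<delta> i) = 1 + \<delta> * exp (shell_L d \<delta> i)"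
  using assms by (simp add: shell_c_def shell_width_def add_pos_pos)

lemma anchored_vol_zero: "anchored_vol (0 :: real ^ 'n) = 0"
  by (simp add: anchored_vol_def)

lemma anchored_vol_shell_b: "anchored_vol (shell_b \<delta> j :: real ^ 'n) = \<delta>"
  by (simp add: anchored_vol_def shell_b_def)

lemma anchored_vol_shell_y:
  "anchored_vol (shell_y \<delta> i n :: real ^ 'n)
     = exp (- shell_c CARD('n) \<delta> i * real (\<Sum>j\<in>UNIV. n $ j) / real CARD('n))"
  by (simp add: anchored_vol_def shell_y_def exp_sum[symmetric] sum_distrib_left
      sum_divide_distrib sum_negf)

lemma anchored_vol_shell_x:
  "anchored_vol (shell_x \<delta> i n :: real ^ 'n)
     = anchored_vol (shell_y \<delta> i n :: real ^ 'n) * exp (- shell_c CARD('n) \<delta> i)"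
proof -
  let ?c = "shell_c CARD('n) \<delta> i"
  have "shell_x \<delta> i n $ j = shell_y \<delta> i n $ j * exp (- ?c / real CARD('n))" for j :: 'n
    by (simp add: shell_x_def shell_y_def exp_add[symmetric] add_divide_distrib diff_divide_distrib
        ring_distribs)
  then have "anchored_vol (shell_x \<delta> i n :: real ^ 'n)
      = anchored_vol (shell_y \<delta> i n :: real ^ 'n) * exp (- ?c / real CARD('n)) ^ CARD('n)"
    by (simp add: anchored_vol_def prod.distrib)
  also have "exp (- ?c / real CARD('n)) ^ CARD('n) = exp (- ?c)"
    by (simp add: exp_of_nat_mult[symmetric])
  finally show ?thesis .
qed

text \<open>
  With \<open>s = |n|\<close>, membership in \<open>A\<^sub>i\<close> gives \<open>c s / d \<ge> L - c\<close>; the bound is attained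
  when this is an equality, which is why the shell starts one full width \<open>c\<close> below \<open>L\<close>.
\<close>

lemma shell_cell_gap_le:
  fixes n :: "nat ^ 'n"
  assumes "0 < \<delta>" and n: "n \<in> shell_A \<delta> i"
  shows "anchored_vol (shell_y \<delta> i n) - anchored_vol (shell_x \<delta> i n) \<le> \<delta>"
proof -
  let ?d = "real CARD('n)" and ?s = "real (\<Sum>j\<in>UNIV. n $ j)"
  let ?c = "shell_c CARD('n) \<delta> i" and ?L = "shell_L CARD('n) \<delta> i"
  have c: "0 < ?c" using assms(1) by (rule shell_c_pos)
  have "\<lceil>?d * (?L / ?c - 1)\<rceil> \<le> int (\<Sum>j\<in>UNIV. n $ j)"
    using n by (simp add: shell_A_def shell_rminus_def)
  then have "?d * (?L / ?c - 1) \<le> ?s"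
    by (simp add: ceiling_le_iff)
  then have "?L - ?c \<le> ?c * ?s / ?d"
    using c by (simp add: field_simps)
  then have y: "anchored_vol (shell_y \<delta> i n) \<le> exp (?c - ?L)"
    by (simp add: anchored_vol_shell_y)
  have "anchored_vol (shell_y \<delta> i n) - anchored_vol (shell_x \<delta> i n)
      = anchored_vol (shell_y \<delta> i n) * (1 - exp (- ?c))"
    by (simp add: anchored_vol_shell_x algebra_simps)
  also have "\<dots> \<le> exp (?c - ?L) * (1 - exp (- ?c))"
    using y c by (intro mult_right_mono) auto
  also have "\<dots> = exp (- ?L) * (exp ?c - 1)"
    by (simp add: exp_diff exp_minus field_simps)
  also have "\<dots> = \<delta>"
    using assms(1) by (simp add: exp_shell_c exp_minus)
  finally show ?thesis .
qed

lemma shell_corners: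
  fixes n :: "nat ^ 'n"
  assumes "0 < \<delta>"
  shows "shell_x \<delta> i n \<in> {0..1}" "shell_y \<delta> i n \<in> {0..1}" "shell_x \<delta> i n \<le> shell_y \<delta> i n"
proof -
  have c: "0 < shell_c CARD('n) \<delta> i" using assms by (rule shell_c_pos)
  show "shell_x \<delta> i n \<in> {0..1}" "shell_y \<delta> i n \<in> {0..1}"
    using c by (auto simp: less_eq_vec_def shell_x_def shell_y_def)
  show "shell_x \<delta> i n \<le> shell_y \<delta> i n"
    using c by (auto simp: less_eq_vec_def shell_x_def shell_y_def intro!: divide_right_mono)
qed

lemma shell_b_in_cube:
  assumes "0 < \<delta>" "\<delta> < 1"
  shows "shell_b \<delta> j \<in> {0..1}"
  using assms by (auto simp: less_eq_vec_def shell_b_def)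

lemma finite_shell_A: "finite (shell_A \<delta> i :: (nat ^ 'n) set)"
proof (rule finite_subset)
  let ?R = "nat (shell_rplus CARD('n) \<delta> i)"
  show "shell_A \<delta> i \<subseteq> vec_lambda ` (PiE UNIV (\<lambda>_ :: 'n. {..?R}))"
  proof
    fix n :: "nat ^ 'n"
    assume "n \<in> shell_A \<delta> i"
    then have "(\<Sum>j\<in>UNIV. n $ j) \<le> ?R"
      unfolding shell_A_def mem_Collect_eq by linarith
    moreover have "n $ k \<le> (\<Sum>j\<in>UNIV. n $ j)" for k
      by (rule member_le_sum) auto
    ultimately have "vec_nth n \<in> PiE UNIV (\<lambda>_. {..?R})"
      by (auto intro: order_trans)
    then show "n \<in> vec_lambda ` (PiE UNIV (\<lambda>_ :: 'n. {..?R}))"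
      by (intro image_eqI[of _ _ "vec_nth n"]) auto
  qed
  show "finite (vec_lambda ` (PiE UNIV (\<lambda>_ :: 'n. {..?R})))"
    by (intro finite_imageI finite_PiE) auto
qed

section \<open>Locating a point in a cell\<close>

lemma shell_level_exists:
  assumes "d \<ge> 1" "0 < \<delta>" "\<delta> < 1" and "0 \<le> T" "T < real d * ln (inverse \<delta>)"
  shows "\<exists>i < shell_J d \<delta>. shell_L d \<delta> i \<le> T \<and> T < shell_L d \<delta> (Suc i)"
proof -
  define k where "k = (LEAST k. T < shell_L d \<delta> k)"
  have J: "T < shell_L d \<delta> (shell_J d \<delta>)"
    using assms by (simp add: shell_J_attained)
  have k: "T < shell_L d \<delta> k"
    unfolding k_def using J by (rule LeastI)
  have "k \<le> shell_J d \<delta>"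
    unfolding k_def using J by (rule Least_le)
  moreover obtain i where i: "k = Suc i"
    using k \<open>0 \<le> T\<close> by (cases k) auto
  moreover have "\<not> T < shell_L d \<delta> i"
    using i not_less_Least[of i "\<lambda>k. T < shell_L d \<delta> k"] unfolding k_def by simp
  ultimately show ?thesis
    using k by (intro exI[of _ i]) auto
qed

text \<open>
  The cell that contains \<open>z\<close> is found by rounding \<open>- d ln z\<^sub>j / c\<close> down. A real number exceeds its
  floor by less than \<open>1\<close>, so \<open>|n|\<close> lies between \<open>d T / c - d\<close> and \<open>d T / c\<close>; since \<open>T < L\<^sub>i\<^sub>+\<^sub>1\<close>
  is strict, the integer \<open>|n|\<close> is at most \<open>\<lceil>d L\<^sub>i\<^sub>+\<^sub>1 / c\<rceil> - 1\<close>.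
\<close>

lemma shell_cells_cover:
  fixes z :: "real ^ 'n"
  assumes "0 < \<delta>" and z: "\<And>j. 0 < z $ j" "\<And>j. z $ j \<le> 1"
    and lo: "shell_L CARD('n) \<delta> i \<le> (\<Sum>j\<in>UNIV. - ln (z $ j))"
    and hi: "(\<Sum>j\<in>UNIV. - ln (z $ j)) < shell_L CARD('n) \<delta> (Suc i)"
  shows "\<exists>n \<in> shell_A \<delta> i. shell_x \<delta> i n \<le> z \<and> z \<le> shell_y \<delta> i n"
proof -
  let ?d = "real CARD('n)" and ?T = "\<Sum>j\<in>UNIV. - ln (z $ j)"
  let ?c = "shell_c CARD('n) \<delta> i"
  have c: "0 < ?c" using assms(1) by (rule shell_c_pos)
  define q where "q j = ?d * - ln (z $ j) / ?c" for j
  define n :: "nat ^ 'n" where "n = (\<chi> j. nat \<lfloor>q j\<rfloor>)"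
  have q0: "0 \<le> q j" for j
    unfolding q_def using z[of j] c by (intro divide_nonneg_pos mult_nonneg_nonneg) auto
  have n_eq: "real (n $ j) = of_int \<lfloor>q j\<rfloor>" for j
    using q0[of j] by (simp add: n_def of_nat_nat)
  have n_le: "real (n $ j) \<le> q j" for j
    unfolding n_eq by linarith
  have q_le: "q j \<le> real (n $ j) + 1" for j
    unfolding n_eq by linarith
  have z_eq: "z $ j = exp (- ?c * q j / ?d)" for j
    using c z(1)[of j] by (simp add: q_def)
  have sum_q: "(\<Sum>j\<in>UNIV. q j) = ?d * ?T / ?c"
    by (simp only: q_def sum_distrib_left sum_divide_distrib)

  have "real (\<Sum>j\<in>UNIV. n $ j) \<le> (\<Sum>j\<in>UNIV. q j)"
    unfolding of_nat_sum by (rule sum_mono) (rule n_le)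
  also have "\<dots> < ?d * shell_L CARD('n) \<delta> (Suc i) / ?c"
    unfolding sum_q using hi c by (intro divide_strict_right_mono mult_strict_left_mono) auto
  finally have up: "int (\<Sum>j\<in>UNIV. n $ j) \<le> shell_rplus CARD('n) \<delta> i"
    unfolding shell_rplus_def by linarith

  have "(\<Sum>j\<in>UNIV. q j) \<le> (\<Sum>j\<in>UNIV. real (n $ j) + 1)"
    by (rule sum_mono) (rule q_le)
  then have "?d * ?T / ?c - ?d \<le> real (\<Sum>j\<in>UNIV. n $ j)"
    unfolding sum_q by (simp add: sum.distrib)
  moreover have "?d * (shell_L CARD('n) \<delta> i / ?c - 1) \<le> ?d * ?T / ?c - ?d"
    using divide_right_mono[OF mult_left_mono[OF lo, of ?d], of ?c] c by (simp add: algebra_simps)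
  ultimately have "shell_rminus CARD('n) \<delta> i \<le> int (\<Sum>j\<in>UNIV. n $ j)"
    unfolding shell_rminus_def by (simp add: ceiling_le_iff del: of_nat_sum)
  with up have "n \<in> shell_A \<delta> i"
    by (simp add: shell_A_def)
  moreover have "shell_x \<delta> i n \<le> z"
    unfolding less_eq_vec_def shell_x_def z_eq
    using c q_le by (auto intro!: divide_right_mono)
  moreover have "z \<le> shell_y \<delta> i n"
    unfolding less_eq_vec_def shell_y_def z_eq
    using c n_le by (auto intro!: divide_right_mono)
  ultimately show ?thesis by blast
qed

text \<open>
  The last level \<open>d ln (1/\<delta>)\<close> is the value of \<open>\<Sum>j. - ln z\<^sub>j\<close> at the corner where every coordinate
  is \<open>\<delta>\<close>. A point above \<open>\<delta>\<close> in every coordinate therefore stays strictly below it and is caught by a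
  shell.
\<close>

lemma slab_or_shell_cell [consumes 3]:
  fixes z :: "real ^ 'n"
  assumes \<delta>: "0 < \<delta>" "\<delta> < 1" and z: "z \<in> {0..1}"
  obtains (slab) j where "z \<le> shell_b \<delta> j"
  | (cell) i n where "i < shell_J CARD('n) \<delta>" "n \<in> shell_A \<delta> i"
      "shell_x \<delta> i n \<le> z" "z \<le> shell_y \<delta> i n"
proof (cases "\<exists>j. z $ j \<le> \<delta>")
  case True
  then obtain j where "z $ j \<le> \<delta>" ..
  then have "z \<le> shell_b \<delta> j"
    using z by (auto simp: less_eq_vec_def shell_b_def)
  then show ?thesis by (rule slab)
next
  case False
  then have gt: "\<delta> < z $ j" for j by (meson not_le)
  then have pos: "0 < z $ j" for j using \<delta>(1) less_trans by blast
  have le: "z $ j \<le> 1" for j using z by (simp add: less_eq_vec_def)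
  let ?T = "\<Sum>j\<in>UNIV. - ln (z $ j)"
  have "0 \<le> ?T"
    using pos le by (intro sum_nonneg) simp
  moreover have "?T < (\<Sum>j\<in>(UNIV :: 'n set). ln (inverse \<delta>))"
    using pos gt \<delta> by (intro sum_strict_mono) (auto simp: ln_inverse)
  ultimately obtain i where "i < shell_J CARD('n) \<delta>" "shell_L CARD('n) \<delta> i \<le> ?T"
    "?T < shell_L CARD('n) \<delta> (Suc i)"
    using shell_level_exists[of "CARD('n)" \<delta> ?T] \<delta> by (auto simp: Suc_le_eq)
  then show ?thesis
    using shell_cells_cover[OF \<delta>(1) pos le] cell by blast
qed

section \<open>The bracketing cover and the cover by corners\<close>

lemma shell_family_delta_bracket:
  fixes B :: "(real ^ 'n) set"
  assumes \<delta>: "0 < \<delta>" "\<delta> < 1" and B: "B \<in> shell_family \<delta>"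
  shows "delta_bracket \<delta> B"
proof -
  from B consider (slab) j where "B = {0..shell_b \<delta> j}"
    | (cell) i n where "n \<in> shell_A \<delta> i" "B = {shell_x \<delta> i n..shell_y \<delta> i n}"
    by (auto simp: shell_family_def)
  then show ?thesis
  proof cases
    case slab
    moreover have "anchored_vol (shell_b \<delta> j) - anchored_vol (0 :: real ^ 'n) \<le> \<delta>"
      by (simp add: anchored_vol_shell_b anchored_vol_zero)
    ultimately show ?thesis
      unfolding delta_bracket_def using shell_b_in_cube[OF \<delta>, of j]
      by (intro bexI[of _ 0] bexI[of _ "shell_b \<delta> j"]) (auto simp: less_eq_vec_def)
  next
    case cell
    then show ?thesis
      unfolding delta_bracket_def using shell_corners[OF \<delta>(1)] shell_cell_gap_le[OF \<delta>(1)] by blast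
  qed
qed

lemma finite_shell_indexed:
  "finite {f i n | i n. i < shell_J CARD('n) \<delta> \<and> n \<in> (shell_A \<delta> i :: (nat ^ 'n) set)}"
proof (rule finite_subset)
  show "{f i n | i n. i < shell_J CARD('n) \<delta> \<and> n \<in> (shell_A \<delta> i :: (nat ^ 'n) set)}
      \<subseteq> (\<Union>i<shell_J CARD('n) \<delta>. f i ` shell_A \<delta> i)"
    by blast
qed (simp add: finite_shell_A)

theorem theorem5p1:
  fixes \<delta> :: real
  assumes "0 < \<delta>" and "\<delta> < 1"
  shows "delta_bracketing_cover \<delta> (shell_family \<delta> :: (real ^ 'n) set set) \<and>
         delta_cover \<delta> (shell_points \<delta> :: (real ^ 'n) set)"
proof
  show "delta_bracketing_cover \<delta> (shell_family \<delta> :: (real ^ 'n) set set)"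
    unfolding delta_bracketing_cover_def
  proof (intro conjI ballI)
    show "finite (shell_family \<delta> :: (real ^ 'n) set set)"
      unfolding shell_family_def by (intro finite_UnI finite_shell_indexed) (simp add: full_SetCompr_eq)
    show bracket: "delta_bracket \<delta> B" if "B \<in> shell_family \<delta>" for B :: "(real ^ 'n) set"
      using assms that by (rule shell_family_delta_bracket)
    show "\<Union> (shell_family \<delta> :: (real ^ 'n) set set) = {0..1}"
    proof
      show "\<Union> (shell_family \<delta> :: (real ^ 'n) set set) \<subseteq> {0..1}"
        using bracket unfolding delta_bracket_def by fastforce
    next
      show "{0..1} \<subseteq> \<Union> (shell_family \<delta> :: (real ^ 'n) set set)"
      proof
        fix z :: "real ^ 'n"
        assume z: "z \<in> {0..1}"
        from assms z show "z \<in> \<Union> (shell_family \<delta>)"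
        proof (cases rule: slab_or_shell_cell)
          case (slab j)
          then have "z \<in> {0..shell_b \<delta> j}" using z by simp
          then show ?thesis unfolding shell_family_def by blast
        next
          case (cell i n)
          then have "z \<in> {shell_x \<delta> i n..shell_y \<delta> i n}" by simp
          then show ?thesis unfolding shell_family_def using cell(1,2) by blast
        qed
      qed
    qed
  qed
next
  show "delta_cover \<delta> (shell_points \<delta> :: (real ^ 'n) set)"
    unfolding delta_cover_def
  proof (intro conjI ballI)
    show "finite (shell_points \<delta> :: (real ^ 'n) set)"
      unfolding shell_points_def by (intro finite_UnI finite_shell_indexed) (simp add: full_SetCompr_eq)
    show "shell_points \<delta> \<subseteq> ({0..1} :: (real ^ 'n) set)"
      unfolding shell_points_def using shell_b_in_cube[OF assms] shell_corners[OF assms(1)] by blast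
    fix z :: "real ^ 'n"
    assume z: "z \<in> {0..1}"
    from assms z show "\<exists>x\<in>shell_points \<delta> \<union> {0}. \<exists>y\<in>shell_points \<delta> \<union> {0}.
        x \<le> z \<and> z \<le> y \<and> anchored_vol y - anchored_vol x \<le> \<delta>"
    proof (cases rule: slab_or_shell_cell)
      case (slab j)
      \<comment> \<open>The lower corner here is the origin, which \<open>\<Gamma>\<close> itself does not contain.\<close>
      have "shell_b \<delta> j \<in> shell_points \<delta>"
        unfolding shell_points_def by blast
      then show ?thesis
        using slab z
        by (intro bexI[of _ 0] bexI[of _ "shell_b \<delta> j"])
          (auto simp: anchored_vol_shell_b anchored_vol_zero)
    next
      case (cell i n)
      have "shell_x \<delta> i n \<in> shell_points \<delta>" "shell_y \<delta> i n \<in> shell_points \<delta>"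
        unfolding shell_points_def using cell(1,2) by blast+
      then show ?thesis
        using cell(3,4) shell_cell_gap_le[OF assms(1) cell(2)] by blast
    qed
  qed
qed

end
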